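(* Let $\mathfrak{g}$ be a finite-dimensional quadratic Lie algebra over $\mathbb{C}$. Let $m$ and $n$ be natural numbers with $m\leq n$ and let $\mathbf{x}$ be an element of $\mathfrak{g}_\infty$. Then $$\operatorname{mod}_{m,n}(\mathbf{x})\geq (n-m)\chi(\mathfrak{g}).$$
   Context: Natural numbers include $0$. A Lie algebra is quadratic if it admits a non-degenerate symmetric bilinear form $K$ that is invariant, i.e. $K([x,y],z)=K(x,[y,z])$ for all $x,y,z$. For a finite-dimensional complex Lie algebra $\mathfrak{g}$, let $\mathfrak{g}_\infty=\mathfrak{g}\otimes\mathbb{C}[T]$ be the Lie algebra with bracket extended $\mathbb{C}[T]$-bilinearly; its elements are written $\mathbf{x}=\sum_{k\in\mathbb{N}}x_k\otimes T^k$ with $x_k\in\mathfrak{g}$ (finitely many nonzero). For $m\in\mathbb{N}$ let $\mathfrak{g}_m=\mathfrak{g}_\infty/(\mathfrak{g}\otimes T^{m+1}\mathbb{C}[T])$ (the $m$-th generalized Takiff Lie algebra; $\mathfrak{g}_0=\mathfrak{g}$), and let $\mathbf{x}(m)=(x_0,\dots,x_m)$ be the image of $\mathbf{x}$ in $\mathfrak{g}_m$. For an element $z$ of a Lie algebra $\mathfrak{h}$, $\mathfrak{h}^z$ is its centralizer in $\mathfrak{h}$; for $f\in\mathfrak{h}^*$, $\mathfrak{h}^f=\{y\in\mathfrak{h}: f([y,\mathfrak{h}])=0\}$. The index of $\mathfrak{h}$ is $\chi(\mathfrak{h})=\min_{f\in\mathfrak{h}^*}\dim\mathfrak{h}^f$.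 For $m\le n$ in $\mathbb{N}$ and $\mathbf{x}\in\mathfrak{g}_\infty$, the $(m,n)$-modality of $\mathbf{x}$ is $$\operatorname{mod}_{m,n}(\mathbf{x})=\min_{\mathbf{y}\in\mathfrak{g}_\infty,\ \mathbf{y}(m)=\mathbf{x}(m)}\dim\mathfrak{g}_n^{\mathbf{y}(n)}-\dim\mathfrak{g}_m^{\mathbf{x}(m)}.$$ *)

theory Defs
  imports Complex_Main "HOL-Computational_Algebra.Polynomial"
begin

section \<open>Lie algebras carried by a subspace of a vector space\<close>

text \<open>
  The carrier \<^term>\<open>L\<close> is a subspace of an ambient vector space, so that the Takiff algebras
  below, whose dimension depends on a natural number, can all live in a single type. A Lie algebra
  that is a whole type is the case \<^term>\<open>L = UNIV\<close>.
\<close>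

locale lie_algebra = vector_space scale
  for scale :: "'k::field \<Rightarrow> 'v::ab_group_add \<Rightarrow> 'v" (infixr \<open>*s\<close> 75) +
  fixes L :: "'v set" and br :: "'v \<Rightarrow> 'v \<Rightarrow> 'v"
  assumes subspace_carrier: "subspace L"
    and br_closed: "\<lbrakk>x \<in> L; y \<in> L\<rbrakk> \<Longrightarrow> br x y \<in> L"
    and br_add_left: "\<lbrakk>x \<in> L; y \<in> L; z \<in> L\<rbrakk> \<Longrightarrow> br (x + y) z = br x z + br y z"
    and br_add_right: "\<lbrakk>x \<in> L; y \<in> L; z \<in> L\<rbrakk> \<Longrightarrow> br x (y + z) = br x y + br x z"
    and br_scale_left: "\<lbrakk>x \<in> L; y \<in> L\<rbrakk> \<Longrightarrow> br (c *s x) y = c *s br x y"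
    and br_scale_right: "\<lbrakk>x \<in> L; y \<in> L\<rbrakk> \<Longrightarrow> br x (c *s y) = c *s br x y"
    and br_self: "x \<in> L \<Longrightarrow> br x x = 0"
    and jacobi: "\<lbrakk>x \<in> L; y \<in> L; z \<in> L\<rbrakk>
      \<Longrightarrow> br x (br y z) + br y (br z x) + br z (br x y) = 0"

definition linear_form_on ::
    "('k::field \<Rightarrow> 'v::ab_group_add \<Rightarrow> 'v) \<Rightarrow> 'v set \<Rightarrow> ('v \<Rightarrow> 'k) \<Rightarrow> bool" where
  "linear_form_on scale L f \<longleftrightarrow>
     (\<forall>x\<in>L. \<forall>y\<in>L. f (x + y) = f x + f y) \<and> (\<forall>c. \<forall>x\<in>L. f (scale c x) = c * f x)"

definition quadratic_lie_algebra ::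
    "('k::field \<Rightarrow> 'v::ab_group_add \<Rightarrow> 'v) \<Rightarrow> 'v set \<Rightarrow> ('v \<Rightarrow> 'v \<Rightarrow> 'v) \<Rightarrow> bool" where
  "quadratic_lie_algebra scale L br \<longleftrightarrow> lie_algebra scale L br \<and>
     (\<exists>K :: 'v \<Rightarrow> 'v \<Rightarrow> 'k.
        (\<forall>x\<in>L. linear_form_on scale L (\<lambda>y. K x y)) \<and>
        (\<forall>y\<in>L. linear_form_on scale L (\<lambda>x. K x y)) \<and>
        (\<forall>x\<in>L. \<forall>y\<in>L. K x y = K y x) \<and>
        (\<forall>x\<in>L. (\<forall>y\<in>L. K x y = 0) \<longrightarrow> x = 0) \<and>
        (\<forall>x\<in>L. \<forall>y\<in>L. \<forall>z\<in>L. K (br x y) z = K x (br y z)))"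

definition lie_centralizer :: "'v set \<Rightarrow> ('v \<Rightarrow> 'v \<Rightarrow> 'v::zero) \<Rightarrow> 'v \<Rightarrow> 'v set" where
  "lie_centralizer L br z = {y \<in> L. br y z = 0}"

definition lie_stabilizer :: "'v set \<Rightarrow> ('v \<Rightarrow> 'v \<Rightarrow> 'v) \<Rightarrow> ('v \<Rightarrow> 'k::zero) \<Rightarrow> 'v set" where
  "lie_stabilizer L br f = {y \<in> L. \<forall>z\<in>L. f (br y z) = 0}"

text \<open>
  The infima below are over nonempty sets of natural numbers, hence are attained
  (\<open>Inf_nat_def1\<close>).
\<close>

definition lie_index ::
    "('k::field \<Rightarrow> 'v::ab_group_add \<Rightarrow> 'v) \<Rightarrow> 'v set \<Rightarrow> ('v \<Rightarrow> 'v \<Rightarrow> 'v) \<Rightarrow> nat" where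
  "lie_index scale L br =
     (INF f \<in> {f :: 'v \<Rightarrow> 'k. linear_form_on scale L f}.
        vector_space.dim scale (lie_stabilizer L br f))"

section \<open>The current algebra and the Takiff algebras\<close>

text \<open>
  For a Lie algebra that is the whole type \<^typ>\<open>'a\<close>, the current algebra
  (tensor product with the polynomials in one variable \<open>T\<close>) is the type \<^typ>\<open>'a poly\<close>:
  the coefficient of index \<open>k\<close> of \<open>p\<close> is the component at \<open>T^k\<close>.
\<close>

definition poly_scale :: "('k \<Rightarrow> 'a \<Rightarrow> 'a::zero) \<Rightarrow> 'k \<Rightarrow> 'a poly \<Rightarrow> 'a poly" where
  "poly_scale scale c p = map_poly (scale c) p"

definition current_bracket ::
    "('a \<Rightarrow> 'a \<Rightarrow> 'a) \<Rightarrow> 'a::comm_monoid_add poly \<Rightarrow> 'a poly \<Rightarrow> 'a poly" where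
  "current_bracket br p q =
     (\<Sum>i\<le>degree p. \<Sum>j\<le>degree q. monom (br (coeff p i) (coeff q j)) (i + j))"

text \<open>
  The Takiff algebra of order \<open>m\<close> is the quotient of the current algebra by the ideal of
  polynomials divisible by \<open>T^(m+1)\<close>. A class is represented by its unique element of degree at
  most \<open>m\<close>, that is, by the tuple of its coefficients of index \<open>0,\<dots>,m\<close>. Truncation is the
  quotient map: see \<open>truncate_hom\<close>, \<open>truncate_surj\<close>, \<open>truncate_kernel\<close> below.
\<close>

definition truncate :: "nat \<Rightarrow> 'a::zero poly \<Rightarrow> 'a poly" where
  "truncate m p = poly_cutoff (Suc m) p"

definition takiff_carrier :: "nat \<Rightarrow> 'a::zero poly set" where
  "takiff_carrier m = {p. degree p \<le> m}"

definition takiff_bracket ::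
    "('a \<Rightarrow> 'a \<Rightarrow> 'a) \<Rightarrow> nat \<Rightarrow> 'a::comm_monoid_add poly \<Rightarrow> 'a poly \<Rightarrow> 'a poly" where
  "takiff_bracket br m p q = truncate m (current_bracket br p q)"

definition takiff_centralizer_dim ::
    "('k::field \<Rightarrow> 'a::ab_group_add \<Rightarrow> 'a) \<Rightarrow> ('a \<Rightarrow> 'a \<Rightarrow> 'a) \<Rightarrow> nat \<Rightarrow> 'a poly \<Rightarrow> nat" where
  "takiff_centralizer_dim scale br m z =
     vector_space.dim (poly_scale scale)
       (lie_centralizer (takiff_carrier m) (takiff_bracket br m) z)"

definition modality ::
    "('k::field \<Rightarrow> 'a::ab_group_add \<Rightarrow> 'a) \<Rightarrow> ('a \<Rightarrow> 'a \<Rightarrow> 'a) \<Rightarrow> nat \<Rightarrow> nat \<Rightarrow> 'a poly \<Rightarrow> int" where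
  "modality scale br m n x =
     int (INF y \<in> {y. truncate m y = truncate m x}.
            takiff_centralizer_dim scale br n (truncate n y))
     - int (takiff_centralizer_dim scale br m (truncate m x))"

subsection \<open>The constructions are Lie algebras, and truncation is a quotient map\<close>

lemma coeff_truncate: "coeff (truncate m p) k = (if k \<le> m then coeff p k else 0)"
  by (simp add: truncate_def coeff_poly_cutoff less_Suc_eq_le)

lemma truncate_in_carrier: "truncate m p \<in> takiff_carrier m"
  by (auto simp: takiff_carrier_def coeff_truncate intro!: degree_le)

lemma truncate_id: "p \<in> takiff_carrier m \<Longrightarrow> truncate m p = p"
  by (auto simp: takiff_carrier_def poly_eq_iff coeff_truncate coeff_eq_0)

lemma truncate_surj: "range (truncate m) = takiff_carrier m"
  using truncate_in_carrier truncate_id by (metis image_subsetI rangeI subsetI subset_antisym)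

lemma truncate_kernel: "truncate m p = 0 \<longleftrightarrow> (\<forall>k\<le>m. coeff p k = 0)"
  by (auto simp: poly_eq_iff coeff_truncate)

lemma truncate_add: "truncate m (p + q) = truncate m p + truncate m q"
  for p q :: "'a::comm_monoid_add poly"
  by (simp add: poly_eq_iff coeff_truncate)

lemma poly_monom_add_induct [case_names monom add]:
  fixes p :: "'a::ab_group_add poly"
  assumes "\<And>a k. P (monom a k)" and "\<And>p q. P p \<Longrightarrow> P q \<Longrightarrow> P (p + q)"
  shows "P p"
proof -
  have "P (\<Sum>i\<le>n. monom (f i) i)" for n and f :: "nat \<Rightarrow> 'a"
    by (induction n) (auto intro: assms)
  then show ?thesis by (metis poly_as_sum_of_monoms)
qed

locale type_lie_algebra = lie_algebra scale UNIV br
  for scale :: "'k::field \<Rightarrow> 'a::ab_group_add \<Rightarrow> 'a" (infixr \<open>*s\<close> 75) and br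
begin

abbreviation cbr where "cbr \<equiv> current_bracket br"

lemma br_zero_left [simp]: "br 0 x = 0"
  using br_scale_left[of 0 x 0] by simp

lemma br_zero_right [simp]: "br x 0 = 0"
  using br_scale_right[of x 0 0] by simp

lemma coeff_poly_scale: "coeff (poly_scale (*s) c p) k = c *s coeff p k"
  by (simp add: poly_scale_def coeff_map_poly)

lemma coeff_cbr: "coeff (cbr p q) k = (\<Sum>i\<le>k. br (coeff p i) (coeff q (k - i)))"
proof -
  have "coeff (cbr p q) k =
      (\<Sum>i\<le>degree p. \<Sum>j\<le>degree q. if i + j = k then br (coeff p i) (coeff q j) else 0)"
    by (simp add: current_bracket_def coeff_sum)
  also have "\<dots> = (\<Sum>i\<le>degree p. if i \<le> k then br (coeff p i) (coeff q (k - i)) else 0)"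
  proof (rule sum.cong[OF refl])
    fix i
    have "(\<Sum>j\<le>degree q. if i + j = k then br (coeff p i) (coeff q j) else 0) =
        (\<Sum>j\<le>degree q. if j = k - i then (if i \<le> k then br (coeff p i) (coeff q j) else 0) else 0)"
      by (rule sum.cong) auto
    then show "(\<Sum>j\<le>degree q. if i + j = k then br (coeff p i) (coeff q j) else 0) =
        (if i \<le> k then br (coeff p i) (coeff q (k - i)) else 0)"
      by (auto simp: sum.delta coeff_eq_0)
  qed
  also have "\<dots> = (\<Sum>i\<in>{..max k (degree p)}.
      if i \<le> k then br (coeff p i) (coeff q (k - i)) else 0)"
    by (rule sum.mono_neutral_left) (auto simp: coeff_eq_0)
  also have "\<dots> = (\<Sum>i\<le>k. br (coeff p i) (coeff q (k - i)))"
    by (rule sum.mono_neutral_cong_right) auto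
  finally show ?thesis .
qed

lemma cbr_monom: "cbr (monom a i) (monom b j) = monom (br a b) (i + j)"
proof (rule poly_eqI)
  fix k
  have "(\<Sum>l\<le>k. br (if i = l then a else 0) (if j = k - l then b else 0)) =
      (\<Sum>l\<le>k. if l = i then (if j = k - l then br a b else 0) else 0)"
    by (rule sum.cong) auto
  then show "coeff (cbr (monom a i) (monom b j)) k = coeff (monom (br a b) (i + j)) k"
    by (auto simp: coeff_cbr sum.delta)
qed

lemma cbr_add_left: "cbr (p + q) r = cbr p r + cbr q r"
  by (simp add: poly_eq_iff coeff_cbr br_add_left sum.distrib)

lemma cbr_add_right: "cbr p (q + r) = cbr p q + cbr p r"
  by (simp add: poly_eq_iff coeff_cbr br_add_right sum.distrib)

lemma cbr_scale_left: "cbr (poly_scale (*s) c p) q = poly_scale (*s) c (cbr p q)"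
  by (simp add: poly_eq_iff coeff_cbr coeff_poly_scale br_scale_left scale_sum_right)

lemma cbr_scale_right: "cbr p (poly_scale (*s) c q) = poly_scale (*s) c (cbr p q)"
  by (simp add: poly_eq_iff coeff_cbr coeff_poly_scale br_scale_right scale_sum_right)

lemma br_anti: "br x y + br y x = 0"
  using br_self[of "x + y"] br_self[of x] br_self[of y] by (simp add: br_add_left br_add_right add.commute)

lemma cbr_anti: "cbr p q + cbr q p = 0"
proof (induction p rule: poly_monom_add_induct)
  case (monom a i)
  show ?case
  proof (induction q rule: poly_monom_add_induct)
    case (monom b j)
    show ?case by (simp add: cbr_monom add_monom br_anti add.commute[of j i])
  next
    case (add p q)
    have "cbr (monom a i) (p + q) + cbr (p + q) (monom a i) =
        (cbr (monom a i) p + cbr p (monom a i)) + (cbr (monom a i) q + cbr q (monom a i))"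
      by (simp add: cbr_add_left cbr_add_right)
    with add show ?case by simp
  qed
next
  case (add p r)
  have "cbr (p + r) q + cbr q (p + r) = (cbr p q + cbr q p) + (cbr r q + cbr q r)"
    by (simp add: cbr_add_left cbr_add_right)
  with add show ?case by simp
qed

lemma cbr_self: "cbr p p = 0"
proof (induction p rule: poly_monom_add_induct)
  case (monom a k)
  show ?case by (simp add: cbr_monom br_self)
next
  case (add p q)
  then show ?case by (simp add: cbr_add_left cbr_add_right cbr_anti)
qed

lemma cbr_jacobi: "cbr p (cbr q r) + cbr q (cbr r p) + cbr r (cbr p q) = 0"
  (is "?J p q r = 0")
proof -
  have 1: "?J (p + p') q r = ?J p q r + ?J p' q r" for p p' q r
    by (simp add: cbr_add_left cbr_add_right)
  have 2: "?J p (q + q') r = ?J p q r + ?J p q' r" for p q q' r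
    by (simp add: cbr_add_left cbr_add_right)
  have 3: "?J p q (r + r') = ?J p q r + ?J p q r'" for p q r r'
    by (simp add: cbr_add_left cbr_add_right)
  have "?J (monom a i) (monom b j) (monom c k) = 0" for a b c i j k
    using jacobi[of a b c] by (simp add: cbr_monom add_monom ac_simps)
  then have "?J (monom a i) (monom b j) r = 0" for a b i j
    by (induction r rule: poly_monom_add_induct) (simp_all only: 3 add_0)
  then have "?J (monom a i) q r = 0" for a i
    by (induction q rule: poly_monom_add_induct) (simp_all only: 2 add_0)
  then show ?thesis
    by (induction p rule: poly_monom_add_induct) (simp_all only: 1 add_0)
qed

lemma vector_space_poly_scale: "vector_space (poly_scale (*s))"
  by unfold_locales
    (simp_all add: poly_eq_iff coeff_poly_scale scale_right_distrib scale_left_distrib)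

lemma lie_algebra_current: "lie_algebra (poly_scale (*s)) UNIV cbr"
proof -
  interpret P: vector_space "poly_scale (*s)" by (rule vector_space_poly_scale)
  show ?thesis
    by unfold_locales
      (auto simp: cbr_add_left cbr_add_right cbr_scale_left cbr_scale_right cbr_self cbr_jacobi)
qed

lemma truncate_scale: "truncate m (poly_scale (*s) c p) = poly_scale (*s) c (truncate m p)"
  by (simp add: poly_eq_iff coeff_truncate coeff_poly_scale)

lemma truncate_hom:
  "truncate m (cbr p q) = takiff_bracket br m (truncate m p) (truncate m q)"
  by (auto simp: takiff_bracket_def poly_eq_iff coeff_truncate coeff_cbr intro!: sum.cong)

lemma lie_algebra_takiff:
  "lie_algebra (poly_scale (*s)) (takiff_carrier m) (takiff_bracket br m)"
proof -
  interpret C: lie_algebra "poly_scale (*s)" UNIV cbr by (rule lie_algebra_current)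
  have zero: "truncate m (0 :: 'a poly) = 0"
    by (simp add: truncate_def)
  have tr: "takiff_bracket br m p (takiff_bracket br m q r) = truncate m (cbr p (cbr q r))"
    if "p \<in> takiff_carrier m" for p q r
    using truncate_hom[of m p "cbr q r"] that by (simp add: truncate_id takiff_bracket_def)
  have sub: "C.subspace (takiff_carrier m)"
    by (auto simp: C.subspace_def takiff_carrier_def coeff_poly_scale coeff_eq_0
        intro: degree_add_le intro!: degree_le)
  show ?thesis
  proof
    fix x y z :: "'a poly"
    assume "x \<in> takiff_carrier m" "y \<in> takiff_carrier m" "z \<in> takiff_carrier m"
    then show "takiff_bracket br m x (takiff_bracket br m y z) +
        takiff_bracket br m y (takiff_bracket br m z x) +
        takiff_bracket br m z (takiff_bracket br m x y) = 0"
      by (simp add: tr cbr_jacobi zero flip: truncate_add)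
  qed (auto simp: sub takiff_bracket_def truncate_in_carrier truncate_add truncate_scale zero
      cbr_add_left cbr_add_right cbr_scale_left cbr_scale_right cbr_self)
qed

end

end

theory Submission
  imports Defs
begin

text \<open>
  Fix a polynomial \<open>y\<close> with values in \<open>g\<close>, and let \<open>C\<^sub>k\<close> be the centralizer of its truncation in
  the \<open>k\<close>-th Takiff algebra. Multiplication by \<open>T\<close> embeds \<open>C\<^sub>k\<close> into \<open>C\<^bsub>k+1\<^esub>\<close>, with image the elements
  whose constant term vanishes. Hence \<open>dim C\<^bsub>k+1\<^esub> - dim C\<^sub>k\<close> is the dimension of the space
  \<open>A\<^bsub>k+1\<^esub>\<close> of constant terms of \<open>C\<^bsub>k+1\<^esub>\<close> (\<open>dim_centralizer_mod_Suc\<close>), and the theorem follows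
  once every \<open>A\<^sub>k\<close> has dimension at least the index \<open>c\<close> of \<open>g\<close>. The underlying reason is that the
  centralizer of \<open>y\<close> over the field of rational functions has dimension at least \<open>c\<close>; in elementary
  terms this is a count of the space \<open>E\<^sub>d\<close> of all \<open>z\<close> of degree below \<open>d\<close> that commute exactly
  with \<open>y\<close>.

  \<^item> Constant terms of elements of \<open>E\<^sub>d\<close> lie in \<open>A\<^sub>k\<close> for every \<open>k\<close>. Filtering \<open>E\<^sub>d\<close> by powers of
    \<open>T\<close> gives \<open>dim E\<^sub>d \<le> d * dim A\<^sub>k\<close> (\<open>dim_exact_centralizer_le\<close>).
  \<^item> Let \<open>r = dim g - c\<close>. Invariance and non-degeneracy of \<open>K\<close> identify the centralizer of \<open>v\<close> with
    the stabilizer of the form \<open>K v\<close>, so it has dimension at least \<open>c\<close>, and every bracket with a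
    fixed element has rank at most \<open>r\<close>. A bracket \<open>[z, y]\<close> with \<open>z\<close> of degree below \<open>d\<close> has degree
    below \<open>d + degree y\<close>, so its values at \<open>d + degree y\<close> points determine it, and the value at \<open>t\<close>
    lies in a space of dimension at most \<open>r\<close>. Therefore
    \<open>dim E\<^sub>d \<ge> d * dim g - (d + degree y) * r = d * c - degree y * r\<close>
    (\<open>dim_polys_below_le_exact_centralizer\<close>).

  Comparing the two bounds for large \<open>d\<close> yields \<open>dim A\<^sub>k \<ge> c\<close> (\<open>dim_constant_terms_ge\<close>).
\<close>

section \<open>Rank-nullity on finitely spanned subspaces\<close>

text \<open>
  The polynomials form an infinite-dimensional space, so rank-nullity is stated for a finitely
  spanned subspace of an arbitrary space. A basis of the kernel is extended to a basis of the
  subspace; the added vectors are mapped bijectively to a basis of the image.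
\<close>

lemma (in vector_space_pair) rank_nullity_on:
  assumes f: "Vector_Spaces.linear s1 s2 f" and V: "vs1.subspace V"
    and S: "V \<subseteq> vs1.span S" "finite S"
  shows "vs1.dim V = vs1.dim {v \<in> V. f v = 0} + vs2.dim (f ` V)"
proof -
  interpret f: Vector_Spaces.linear s1 s2 f by (rule f)
  let ?N = "{v \<in> V. f v = 0}"
  obtain A where A: "A \<subseteq> ?N" "vs1.independent A" "?N \<subseteq> vs1.span A" "card A = vs1.dim ?N"
    by (rule vs1.basis_exists)
  obtain B where B: "A \<subseteq> B" "B \<subseteq> V" "vs1.independent B" "V \<subseteq> vs1.span B"
    using vs1.maximal_independent_subset_extend[of A V] A(1,2) by blast
  have finB: "finite B"
    using vs1.independent_span_bound[OF S(2) B(3)] B(2) S(1) by blast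
  have indBA: "vs1.independent (B - A)"
    using B(3) vs1.independent_mono by blast
  have span_BA_V: "vs1.span (B - A) \<subseteq> V"
    using B(2) V by (intro vs1.span_minimal) auto
  have inj: "inj_on f (vs1.span (B - A))"
  proof (subst f.inj_on_iff_eq_0[OF vs1.subspace_span], intro ballI impI)
    fix x assume x: "x \<in> vs1.span (B - A)" and "f x = 0"
    then have "x \<in> vs1.span A"
      using span_BA_V A(3) by blast
    \<comment> \<open>The span of \<open>B - A\<close> meets the span of \<open>A\<close> only in zero, since \<open>B\<close> is independent.\<close>
    show "x = 0"
    proof (rule ccontr)
      assume "x \<noteq> 0"
      let ?r = "vs1.representation B x"
      have "vs1.representation (B - A) x = ?r" "vs1.representation A x = ?r"
        using vs1.representation_extend[OF B(3) x] vs1.representation_extend[OF B(3) \<open>x \<in> vs1.span A\<close>] B(1)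
        by auto
      then have "?r b = 0" for b
        by (metis Diff_iff vs1.representation_ne_zero)
      then have "x = 0"
        using vs1.sum_nonzero_representation_eq[OF B(3)] x span_BA_V B(4)
        by (metis (mono_tags, lifting) Collect_empty_eq subsetD sum.empty)
      with \<open>x \<noteq> 0\<close> show False by simp
    qed
  qed
  have "vs2.independent (f ` (B - A))"
    using f.independent_injective_image[OF indBA inj] .
  moreover have "f ` (B - A) \<subseteq> f ` V"
    using B(2) by blast
  moreover have "f ` V \<subseteq> vs2.span (f ` (B - A))"
  proof -
    have "f ` B \<subseteq> vs2.span (f ` (B - A))"
    proof
      fix w assume "w \<in> f ` B"
      then obtain b where b: "b \<in> B" "w = f b" by blast
      show "w \<in> vs2.span (f ` (B - A))"
      proof (cases "b \<in> A")
        case True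
        then show ?thesis using A(1) b vs2.span_zero by auto
      next
        case False
        then show ?thesis using b by (auto intro: vs2.span_base)
      qed
    qed
    then have "vs2.span (f ` B) \<subseteq> vs2.span (f ` (B - A))"
      by (intro vs2.span_minimal) auto
    then show ?thesis
      using f.spans_image[OF B(4)] by blast
  qed
  ultimately have "vs2.dim (f ` V) = card (f ` (B - A))"
    by (simp add: vs2.basis_card_eq_dim)
  also have "\<dots> = card (B - A)"
    using inj vs1.span_superset by (intro card_image) (blast intro: inj_on_subset)
  finally have "vs2.dim (f ` V) = card B - card A"
    using B(1) finB by (simp add: card_Diff_subset finite_subset)
  moreover have "card A \<le> card B"
    using B(1) finB by (rule card_mono[rotated])
  ultimately show ?thesis
    using A(4) vs1.basis_card_eq_dim[OF B(2,4,3)] by simp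
qed

section \<open>Vector-valued polynomials\<close>

locale type_finite_dim_lie_algebra =
  type_lie_algebra scale br + finite_dimensional_vector_space scale Basis
  for scale :: "'k::field_char_0 \<Rightarrow> 'a::ab_group_add \<Rightarrow> 'a" (infixr \<open>*s\<close> 75)
    and br Basis
begin

abbreviation pscale where "pscale \<equiv> poly_scale (*s)"

sublocale P: vector_space pscale
  by (rule vector_space_poly_scale)

sublocale PP: vector_space_pair pscale pscale ..

sublocale PV: vector_space_pair pscale "(*s)" ..

sublocale VV: vector_space_pair "(*s)" "(*s)" ..

definition polys_below :: "nat \<Rightarrow> 'a poly set" where
  "polys_below d = {p. \<forall>i\<ge>d. coeff p i = 0}"

lemma subspace_polys_below: "P.subspace (polys_below d)"
  by (auto simp: P.subspace_def polys_below_def coeff_poly_scale)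

lemma finite_span_polys_below: "\<exists>S. finite S \<and> polys_below d \<subseteq> P.span S"
proof (intro exI conjI)
  let ?S = "(\<lambda>(b, i). monom b i) ` (Basis \<times> {..<d})"
  show "finite ?S"
    using finite_Basis by auto
  show "polys_below d \<subseteq> P.span ?S"
  proof
    fix p assume p: "p \<in> polys_below d"
    have monom: "monom a i \<in> P.span ?S" if "i < d" for a i
    proof -
      have "Vector_Spaces.linear (*s) pscale (\<lambda>a. monom a i)"
        by (auto simp: Vector_Spaces.linear_iff vector_space_axioms P.vector_space_axioms
            add_monom poly_eq_iff coeff_poly_scale)
      then interpret L: Vector_Spaces.linear "(*s)" pscale "\<lambda>a. monom a i" .
      have "monom a i \<in> P.span ((\<lambda>a. monom a i) ` Basis)"
        using L.spans_image[of UNIV Basis] span_Basis by auto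
      moreover have "(\<lambda>a. monom a i) ` Basis \<subseteq> ?S"
        using that by auto
      ultimately show ?thesis
        using P.span_mono by blast
    qed
    have "p = (\<Sum>i<d. monom (coeff p i) i)"
      using p by (auto simp: poly_eq_iff coeff_sum polys_below_def sum.delta' not_less)
    also have "\<dots> \<in> P.span ?S"
      by (intro P.span_sum) (simp add: monom)
    finally show "p \<in> P.span ?S" .
  qed
qed

lemma dim_zero_polys: "V \<subseteq> {0} \<Longrightarrow> P.dim V = 0"
  using P.dim_le_card[of V "{}"] by simp

text \<open>
  A subspace of polynomials is filtered by powers of \<open>T\<close>: the kernel of the constant term
  consists of the multiples of \<open>T\<close>, and division by \<open>T\<close> preserves dimensions.
\<close>

lemma dim_constant_term:
  assumes V: "P.subspace V" "V \<subseteq> polys_below d"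
  shows "P.dim V = P.dim {w. pCons 0 w \<in> V} + dim ((\<lambda>p. coeff p 0) ` V)"
proof -
  obtain S where S: "finite S" "polys_below d \<subseteq> P.span S"
    using finite_span_polys_below by blast
  have lin0: "Vector_Spaces.linear pscale (*s) (\<lambda>p. coeff p 0)"
    by (auto simp: Vector_Spaces.linear_iff vector_space_axioms P.vector_space_axioms
        coeff_poly_scale)
  have linT: "Vector_Spaces.linear pscale pscale (pCons 0)"
    by (auto simp: Vector_Spaces.linear_iff P.vector_space_axioms poly_eq_iff
        coeff_poly_scale coeff_pCons split: nat.split)
  let ?W = "{w. pCons 0 w \<in> V}"
  interpret T: Vector_Spaces.linear pscale pscale "pCons 0" by (rule linT)
  have W: "P.subspace ?W"
    using T.subspace_linear_preimage[OF V(1)] by simp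
  have "?W \<subseteq> polys_below d"
  proof
    fix w assume "w \<in> ?W"
    then have "pCons 0 w \<in> polys_below d" using V(2) by auto
    then have "coeff (pCons 0 w) (Suc i) = 0" if "d \<le> i" for i
      using that by (simp only: polys_below_def mem_Collect_eq le_SucI)
    then show "w \<in> polys_below d" by (simp add: polys_below_def)
  qed
  then have "P.dim ?W = P.dim {w \<in> ?W. pCons 0 w = 0} + P.dim (pCons 0 ` ?W)"
    using PP.rank_nullity_on[OF linT W _ S(1)] S(2) by blast
  moreover have "P.dim {w \<in> ?W. pCons 0 w = 0} = 0"
    by (rule dim_zero_polys) auto
  moreover have "pCons 0 ` ?W = {p \<in> V. coeff p 0 = 0}"
  proof (intro equalityI subsetI)
    fix p assume p: "p \<in> {p \<in> V. coeff p 0 = 0}"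
    obtain a w where "p = pCons a w" by (rule pCons_cases)
    with p show "p \<in> pCons 0 ` ?W" by auto
  qed auto
  ultimately show ?thesis
    using PV.rank_nullity_on[OF lin0 V(1) _ S(1)] V(2) S(2) by auto
qed

lemma dim_polys_below: "P.dim (polys_below d) = d * dim UNIV"
proof (induction d)
  case 0
  show ?case by (rule le_antisym) (simp_all add: dim_zero_polys polys_below_def poly_eq_iff subset_iff)
next
  case (Suc d)
  have "{w. pCons 0 w \<in> polys_below (Suc d)} = polys_below d"
    by (auto simp: polys_below_def coeff_pCons less_eq_nat.simps split: nat.splits)
  moreover have "(\<lambda>p. coeff p 0) ` polys_below (Suc d) = UNIV"
  proof (intro equalityI subsetI UNIV_I)
    fix a :: 'a
    have "[:a:] \<in> polys_below (Suc d)"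
      by (auto simp: polys_below_def coeff_pCons split: nat.splits)
    then show "a \<in> (\<lambda>p. coeff p 0) ` polys_below (Suc d)" by force
  qed
  ultimately show ?case
    using dim_constant_term[OF subspace_polys_below order_refl, of "Suc d"] Suc by simp
qed

definition eval_at :: "'k \<Rightarrow> 'a poly \<Rightarrow> 'a" where
  "eval_at t p = (\<Sum>i\<le>degree p. t ^ i *s coeff p i)"

lemma eval_at_bound: "degree p \<le> d \<Longrightarrow> eval_at t p = (\<Sum>i\<le>d. t ^ i *s coeff p i)"
  unfolding eval_at_def by (rule sum.mono_neutral_left) (auto simp: coeff_eq_0)

lemma linear_eval_at: "Vector_Spaces.linear pscale (*s) (eval_at t)"
proof -
  have "eval_at t (p + q) = eval_at t p + eval_at t q" for p q
    using eval_at_bound[of "p + q" "max (degree p) (degree q)"]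
      eval_at_bound[of p "max (degree p) (degree q)"]
      eval_at_bound[of q "max (degree p) (degree q)"]
    by (simp add: degree_add_le_max scale_right_distrib sum.distrib)
  moreover have "eval_at t (pscale c p) = c *s eval_at t p" for c p
  proof -
    have "degree (pscale c p) \<le> degree p"
      by (intro degree_le) (auto simp: coeff_poly_scale coeff_eq_0)
    then show ?thesis
      using eval_at_bound[of "pscale c p" "degree p"]
      by (simp add: eval_at_def coeff_poly_scale scale_sum_right mult.commute)
  qed
  ultimately show ?thesis
    by (auto simp: Vector_Spaces.linear_iff vector_space_axioms P.vector_space_axioms)
qed

lemma eval_at_add: "eval_at t (p + q) = eval_at t p + eval_at t q"
  using linear_eval_at by (simp add: Vector_Spaces.linear_iff)

lemma eval_at_monom: "eval_at t (monom a i) = t ^ i *s a"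
  using eval_at_bound[of "monom a i" i t]
  by (simp add: degree_monom_le if_distrib[of "\<lambda>x. _ *s x"] cong: if_cong)

lemma eval_at_cbr: "eval_at t (cbr p q) = br (eval_at t p) (eval_at t q)"
proof (induction p rule: poly_monom_add_induct)
  case (monom a i)
  show ?case
    by (induction q rule: poly_monom_add_induct)
      (simp_all add: cbr_monom eval_at_monom br_scale_left br_scale_right power_add
        cbr_add_right eval_at_add br_add_right mult.commute)
next
  case (add p r)
  then show ?case by (simp add: cbr_add_left eval_at_add br_add_left)
qed

text \<open>
  Each coordinate in a basis is a scalar polynomial of degree below \<open>d\<close> that would have \<open>d\<close>
  distinct roots; the points \<open>of_nat j\<close> are distinct in characteristic zero.
\<close>

lemma polys_below_eq_0_if_eval_at_eq_0:
  assumes p: "p \<in> polys_below d" and roots: "\<And>j. j < d \<Longrightarrow> eval_at (of_nat j) p = 0"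
  shows "p = 0"
proof -
  let ?r = "\<lambda>b v. representation Basis v b"
  have r_add: "?r b (u + v) = ?r b u + ?r b v" and r_scale: "?r b (c *s v) = c * ?r b v" for b u v c
    by (simp_all add: representation_add representation_scale independent_Basis span_Basis)
  have r0: "?r b 0 = 0" for b
    using r_scale[where c = 0 and v = 0 and b = b] by simp
  have poly_r: "poly (map_poly (?r b) q) t = ?r b (eval_at t q)" for b q t
  proof (induction q rule: poly_monom_add_induct)
    case (monom a k)
    show ?case
      by (simp add: map_poly_monom r0 poly_monom eval_at_monom r_scale)
  next
    case (add p q)
    have "map_poly (?r b) (p + q) = map_poly (?r b) p + map_poly (?r b) q"
      by (simp add: poly_eq_iff coeff_map_poly r0 r_add)
    with add show ?case by (simp add: eval_at_add r_add)
  qed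
  have "map_poly (?r b) p = 0" for b
  proof (rule ccontr)
    assume nz: "map_poly (?r b) p \<noteq> 0"
    have "of_nat ` {..<d} \<subseteq> {t. poly (map_poly (?r b) p) t = 0}"
      using roots by (auto simp: poly_r r0)
    then have "card ((of_nat :: nat \<Rightarrow> 'k) ` {..<d}) \<le> degree (map_poly (?r b) p)"
      using card_mono[OF poly_roots_finite[OF nz]] card_poly_roots_bound[OF nz] by (meson order_trans)
    then have "d \<le> degree (map_poly (?r b) p)"
      by (simp add: card_image inj_on_def)
    then have "lead_coeff (map_poly (?r b) p) = 0"
      using p by (simp add: coeff_map_poly r0 polys_below_def)
    with nz show False by simp
  qed
  then have "?r b (coeff p i) = 0" for b i
    by (metis coeff_map_poly r0 coeff_0)
  then have "coeff p i = 0" for i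
    using sum_representation_eq[OF independent_Basis, of "coeff p i" Basis] span_Basis finite_Basis
    by simp
  then show ?thesis by (simp add: poly_eq_iff)
qed

text \<open>
  Imposing that the value vanish at one more point lowers the dimension by at most \<open>r\<close>, and
  after \<open>d\<close> points nothing but zero is left.
\<close>

lemma dim_le_if_dim_eval_at_le:
  assumes W: "P.subspace W" "W \<subseteq> polys_below d"
    and r: "\<And>t. dim (eval_at t ` W) \<le> r"
  shows "P.dim W \<le> d * r"
proof -
  obtain S where S: "finite S" "polys_below d \<subseteq> P.span S"
    using finite_span_polys_below by blast
  let ?Z = "\<lambda>k. {w \<in> W. \<forall>j<k. eval_at (of_nat j) w = 0}"
  have Z: "P.subspace (?Z k)" for k
    using W(1) linear_eval_at[unfolded Vector_Spaces.linear_iff] by (auto simp: P.subspace_def eval_at_def[of _ 0])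
  have "P.dim W \<le> P.dim (?Z k) + k * r" for k
  proof (induction k)
    case (Suc k)
    let ?f = "eval_at (of_nat k)"
    have "P.dim (?Z k) = P.dim {w \<in> ?Z k. ?f w = 0} + dim (?f ` ?Z k)"
      using PV.rank_nullity_on[OF linear_eval_at Z _ S(1)] W(2) S(2) by blast
    moreover have "{w \<in> ?Z k. ?f w = 0} = ?Z (Suc k)"
      by (auto simp: less_Suc_eq)
    moreover have "dim (?f ` ?Z k) \<le> r"
      by (rule order_trans[OF dim_subset r]) auto
    ultimately show ?case
      using Suc by simp
  qed simp
  from this[of d] show ?thesis
    using dim_zero_polys[of "?Z d"] polys_below_eq_0_if_eval_at_eq_0 W(2) by fastforce
qed

section \<open>Centralizers of a polynomial\<close>

lemma linear_cbr_left: "Vector_Spaces.linear pscale pscale (\<lambda>z. cbr z y)"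
  by (auto simp: Vector_Spaces.linear_iff P.vector_space_axioms cbr_add_left cbr_scale_left)

lemma cbr_pCons_0: "cbr (pCons 0 w) y = pCons 0 (cbr w y)"
proof (rule poly_eqI)
  fix k
  show "coeff (cbr (pCons 0 w) y) k = coeff (pCons 0 (cbr w y)) k"
    by (cases k) (simp_all add: coeff_cbr sum.atMost_Suc_shift del: sum.atMost_Suc)
qed

lemma cbr_in_polys_below:
  assumes "z \<in> polys_below d"
  shows "cbr z y \<in> polys_below (d + degree y)"
proof -
  have "br (coeff z i) (coeff y (k - i)) = 0" if "d + degree y \<le> k" "i \<le> k" for i k
    using assms that by (cases "d \<le> i") (auto simp: polys_below_def coeff_eq_0)
  then show ?thesis
    by (simp add: polys_below_def coeff_cbr)
qed

text \<open>
  Rank-nullity for the bracket with \<open>y\<close>. Evaluation at \<open>t\<close> is a homomorphism, so the image of the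
  bracket takes values at \<open>t\<close> in the range of the bracket with the single vector \<open>y(t)\<close>.
\<close>

lemma dim_polys_below_le_exact_centralizer:
  assumes r: "\<And>v. dim (range (\<lambda>u. br u v)) \<le> r"
  shows "d * dim UNIV \<le> P.dim {z \<in> polys_below d. cbr z y = 0} + (d + degree y) * r"
proof -
  obtain S where S: "finite S" "polys_below d \<subseteq> P.span S"
    using finite_span_polys_below by blast
  let ?W = "(\<lambda>z. cbr z y) ` polys_below d"
  interpret L: Vector_Spaces.linear pscale pscale "\<lambda>z. cbr z y" by (rule linear_cbr_left)
  have "P.dim (polys_below d) = P.dim {z \<in> polys_below d. cbr z y = 0} + P.dim ?W"
    by (rule PP.rank_nullity_on[OF linear_cbr_left subspace_polys_below S(2,1)])
  moreover have "P.dim ?W \<le> (d + degree y) * r"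
  proof (rule dim_le_if_dim_eval_at_le)
    show "P.subspace ?W"
      by (rule L.subspace_image[OF subspace_polys_below])
    show "?W \<subseteq> polys_below (d + degree y)"
      using cbr_in_polys_below by blast
    fix t
    have "eval_at t ` ?W \<subseteq> range (\<lambda>u. br u (eval_at t y))"
      by (auto simp: eval_at_cbr)
    then show "dim (eval_at t ` ?W) \<le> r"
      by (rule order_trans[OF dim_subset r])
  qed
  ultimately show ?thesis
    by (simp only: dim_polys_below)
qed

text \<open>
  The centralizer in a Takiff algebra, phrased with the bracket of the current algebra: this bracket
  commutes with multiplication by \<open>T\<close>, which relates consecutive values of \<open>k\<close>.
\<close>

definition centralizer_mod :: "nat \<Rightarrow> 'a poly \<Rightarrow> 'a poly set" where
  "centralizer_mod k y = {z. degree z \<le> k \<and> (\<forall>j\<le>k. coeff (cbr z y) j = 0)}"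

lemma lie_centralizer_takiff:
  "lie_centralizer (takiff_carrier k) (takiff_bracket br k) (truncate k y) = centralizer_mod k y"
proof -
  have "takiff_bracket br k z (truncate k y) = truncate k (cbr z y)" if "z \<in> takiff_carrier k" for z
    using that by (simp add: truncate_hom truncate_id)
  then show ?thesis
    by (auto simp: lie_centralizer_def centralizer_mod_def truncate_kernel takiff_carrier_def)
qed

lemma subspace_centralizer_mod: "P.subspace (centralizer_mod k y)"
proof -
  have "degree (pscale c z) \<le> k" if "degree z \<le> k" for c z
    using that by (intro degree_le) (auto simp: coeff_poly_scale coeff_eq_0)
  moreover have "cbr 0 y = 0"
    by (simp add: poly_eq_iff coeff_cbr)
  ultimately show ?thesis
    by (auto simp: P.subspace_def centralizer_mod_def cbr_add_left cbr_scale_left coeff_poly_scale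
        degree_add_le)
qed

lemma centralizer_mod_below: "centralizer_mod k y \<subseteq> polys_below (Suc k)"
  by (auto simp: centralizer_mod_def polys_below_def coeff_eq_0)

lemma dim_centralizer_mod_Suc:
  "P.dim (centralizer_mod (Suc k) y) =
    P.dim (centralizer_mod k y) + dim ((\<lambda>z. coeff z 0) ` centralizer_mod (Suc k) y)"
proof -
  have "{w. pCons 0 w \<in> centralizer_mod (Suc k) y} = centralizer_mod k y"
  proof -
    have "degree (pCons 0 w) \<le> Suc k \<longleftrightarrow> degree w \<le> k" for w :: "'a poly"
      by (simp add: degree_pCons_eq_if)
    moreover have "(\<forall>j\<le>Suc k. coeff (pCons 0 p) j = 0) \<longleftrightarrow> (\<forall>j\<le>k. coeff p j = 0)" for p :: "'a poly"
      by (auto simp: coeff_pCons split: nat.splits)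
    ultimately show ?thesis
      by (simp add: centralizer_mod_def cbr_pCons_0)
  qed
  then show ?thesis
    using dim_constant_term[OF subspace_centralizer_mod centralizer_mod_below, of "Suc k" y]
    by simp
qed

text \<open>
  The space on the left is filtered by powers of \<open>T\<close>. Each of the \<open>d\<close> steps contributes constant
  terms of polynomials commuting with \<open>y\<close>, and truncating these polynomials puts their constant
  terms into the space on the right.
\<close>

lemma dim_exact_centralizer_le:
  "P.dim {z \<in> polys_below d. cbr z y = 0} \<le> d * dim ((\<lambda>z. coeff z 0) ` centralizer_mod k y)"
proof (induction d)
  case 0
  show ?case
    by (simp add: dim_zero_polys polys_below_def poly_eq_iff subset_iff)
next
  case (Suc d)
  let ?E = "\<lambda>d. {z \<in> polys_below d. cbr z y = 0}"
  interpret L: Vector_Spaces.linear pscale pscale "\<lambda>z. cbr z y" by (rule linear_cbr_left)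
  have "?E (Suc d) = polys_below (Suc d) \<inter> {z. cbr z y = 0}" by auto
  then have sub: "P.subspace (?E (Suc d))"
    using P.subspace_inter[OF subspace_polys_below L.subspace_kernel] by simp
  have "{w. pCons 0 w \<in> ?E (Suc d)} = ?E d"
  proof -
    have "pCons 0 w \<in> polys_below (Suc d) \<longleftrightarrow> w \<in> polys_below d" for w
      by (auto simp: polys_below_def coeff_pCons less_eq_nat.simps split: nat.splits)
    then show ?thesis by (auto simp: cbr_pCons_0)
  qed
  moreover have "(\<lambda>z. coeff z 0) ` ?E (Suc d) \<subseteq> (\<lambda>z. coeff z 0) ` centralizer_mod k y"
  proof
    fix a assume "a \<in> (\<lambda>z. coeff z 0) ` ?E (Suc d)"
    then obtain z where z: "cbr z y = 0" "a = coeff z 0" by auto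
    have "coeff (cbr (truncate k z) y) j = coeff (cbr z y) j" if "j \<le> k" for j
      using that by (simp add: coeff_truncate coeff_cbr)
    then have "truncate k z \<in> centralizer_mod k y"
      using z(1) truncate_in_carrier[of k z] by (simp add: centralizer_mod_def takiff_carrier_def)
    then show "a \<in> (\<lambda>z. coeff z 0) ` centralizer_mod k y"
      using z(2) by (intro image_eqI[of _ _ "truncate k z"]) (simp_all add: coeff_truncate)
  qed
  then have "dim ((\<lambda>z. coeff z 0) ` ?E (Suc d)) \<le> dim ((\<lambda>z. coeff z 0) ` centralizer_mod k y)"
    by (rule dim_subset)
  ultimately show ?case
    using dim_constant_term[OF sub, of "Suc d"] Suc by auto
qed

text \<open>
  With \<open>dim UNIV = c + r\<close>, the two bounds on exact centralizers give
  \<open>d * c \<le> d * a + degree y * r\<close> for every \<open>d\<close>, where \<open>a\<close> is the dimension of the space of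
  constant terms; this forces \<open>c \<le> a\<close>.
\<close>

lemma dim_constant_terms_ge:
  assumes c: "\<And>v. c \<le> dim {u. br u v = 0}"
  shows "c \<le> dim ((\<lambda>z. coeff z 0) ` centralizer_mod k y)" (is "c \<le> ?a")
proof (rule ccontr)
  assume "\<not> c \<le> ?a"
  obtain r where r: "dim UNIV = c + r"
    using order_trans[OF c[of 0] dim_subset[OF subset_UNIV]] le_Suc_ex by blast
  have rank: "dim (range (\<lambda>u. br u v)) \<le> r" for v
  proof -
    have "Vector_Spaces.linear (*s) (*s) (\<lambda>u. br u v)"
      by (auto simp: Vector_Spaces.linear_iff vector_space_axioms br_add_left br_scale_left)
    from VV.rank_nullity_on[OF this subspace_UNIV, of Basis]
    have "dim UNIV = dim {u. br u v = 0} + dim (range (\<lambda>u. br u v))"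
      using finite_Basis span_Basis by simp
    with c[of v] r show ?thesis by linarith
  qed
  \<comment> \<open>Any length \<open>d\<close> exceeding the error term \<open>degree y * r\<close> gives the contradiction.\<close>
  define d where "d = Suc (degree y * r)"
  have "d * (c + r) \<le> d * ?a + (d + degree y) * r"
    using dim_polys_below_le_exact_centralizer[OF rank, of d y]
      dim_exact_centralizer_le[of d y k] unfolding r by linarith
  then have "d * c \<le> d * ?a + degree y * r"
    by (simp add: distrib_left distrib_right)
  moreover have "d * ?a + d \<le> d * c"
    using mult_le_mono2[of "Suc ?a" c d] \<open>\<not> c \<le> ?a\<close> by (simp only: mult_Suc_right) linarith
  ultimately have "d \<le> degree y * r"
    by linarith
  then show False
    by (simp add: d_def)
qed

lemma dim_centralizer_mod_growth:
  assumes c: "\<And>v. c \<le> dim {u. br u v = 0}" and "m \<le> n"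
  shows "P.dim (centralizer_mod m y) + (n - m) * c \<le> P.dim (centralizer_mod n y)"
  using \<open>m \<le> n\<close>
proof (induction n rule: dec_induct)
  case (step n)
  have "(Suc n - m) * c = (n - m) * c + c"
    using step.hyps by (simp add: Suc_diff_le)
  then show ?case
    using dim_centralizer_mod_Suc[of n y] dim_constant_terms_ge[OF c, of "Suc n" y] step.IH
    by linarith
qed simp

end

section \<open>Quadratic Lie algebras\<close>

text \<open>
  The stabilizer of the form \<open>K v\<close> is the centralizer of \<open>v\<close>: by invariance
  \<open>K v [u, w] = K [v, u] w\<close>, and by non-degeneracy this vanishes for all \<open>w\<close> only if
  \<open>[v, u] = 0\<close>.
\<close>

lemma lie_index_le_dim_centralizer:
  assumes "quadratic_lie_algebra scale UNIV br"
  shows "lie_index scale UNIV br \<le> vector_space.dim scale {u. br u v = 0}"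
proof -
  interpret lie_algebra scale UNIV br
    using assms unfolding quadratic_lie_algebra_def by (rule conjunct1)
  obtain K where K: "\<forall>v. linear_form_on scale UNIV (K v)" "\<forall>u v. K u v = K v u"
    "\<forall>v. (\<forall>w. K v w = 0) \<longrightarrow> v = 0" "\<forall>u v w. K (br u v) w = K u (br v w)"
    using assms unfolding quadratic_lie_algebra_def ball_UNIV by (elim conjE exE) (rule that; assumption)
  have K0: "K u 0 = 0" for u
    using K(1) unfolding linear_form_on_def by (metis UNIV_I mult_zero_left scale_zero_left)
  have anti: "br u v = 0 \<longleftrightarrow> br v u = 0" for u v
  proof -
    have "br u v + br v u = 0"
      using br_self[of "u + v"] br_self[of u] br_self[of v]
      by (simp add: br_add_left br_add_right add.commute)
    then show ?thesis by (metis add.left_neutral add.right_neutral)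
  qed
  have "lie_stabilizer UNIV br (K v) = {u. br u v = 0}"
  proof -
    have "(\<forall>w. K v (br u w) = 0) \<longleftrightarrow> br v u = 0" for u
    proof
      assume "\<forall>w. K v (br u w) = 0"
      then have "\<forall>w. K (br v u) w = 0" using K(4) by metis
      then show "br v u = 0" using K(3) by blast
    next
      assume "br v u = 0"
      then have "K v (br u w) = K w 0" for w using K(2,4) by metis
      then show "\<forall>w. K v (br u w) = 0" using K0 by simp
    qed
    then show ?thesis by (simp add: lie_stabilizer_def anti)
  qed
  then show ?thesis
    unfolding lie_index_def using K(1) by (metis (mono_tags, lifting) cINF_lower bdd_below_bot mem_Collect_eq)
qed

theorem theorem1p4:
  fixes scale :: "complex \<Rightarrow> 'a::ab_group_add \<Rightarrow> 'a"
    and br :: "'a \<Rightarrow> 'a \<Rightarrow> 'a"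
    and Basis :: "'a set"
    and m n :: nat
    and x :: "'a poly"
  assumes "finite_dimensional_vector_space scale Basis"
    and "quadratic_lie_algebra scale UNIV br"
    and "m \<le> n"
  shows "modality scale br m n x \<ge> (int n - int m) * int (lie_index scale UNIV br)"
proof -
  interpret type_finite_dim_lie_algebra scale br Basis
    using assms(1) conjunct1[OF assms(2)[unfolded quadratic_lie_algebra_def]]
    by (simp add: type_finite_dim_lie_algebra_def type_lie_algebra_def)
  let ?Y = "{y. truncate m y = truncate m x}"
  let ?c = "\<lambda>y. takiff_centralizer_dim scale br n (truncate n y)"
  have "(INF y \<in> ?Y. ?c y) \<in> ?c ` ?Y"
    by (rule Inf_nat_def1) auto
  then obtain y where y: "truncate m y = truncate m x" and min: "(INF y \<in> ?Y. ?c y) = ?c y"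
    by auto
  have dim: "takiff_centralizer_dim scale br k (truncate k z) = P.dim (centralizer_mod k z)" for k z
    by (simp add: takiff_centralizer_dim_def lie_centralizer_takiff)
  have "P.dim (centralizer_mod m y) + (n - m) * lie_index scale UNIV br \<le> P.dim (centralizer_mod n y)"
    using dim_centralizer_mod_growth lie_index_le_dim_centralizer[OF assms(2)] assms(3) .
  then have "takiff_centralizer_dim scale br m (truncate m x) + (n - m) * lie_index scale UNIV br \<le> ?c y"
    by (simp add: dim flip: y)
  then have "int (takiff_centralizer_dim scale br m (truncate m x)) + (int n - int m) * int (lie_index scale UNIV br) \<le> int (?c y)"
    using assms(3) by (simp flip: of_nat_diff of_nat_mult of_nat_add)
  then show ?thesis
    unfolding modality_def min by linarith
qed

end
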